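(* Let $m,n$ be positive integers with $m\le n/2$, let $\rho=m/n$, let $A\in\mathbb{R}^{m\times n}$, and let $\Theta=\operatorname{diag}(\Theta_1,\Theta_2,\dots,\Theta_n)$ be a diagonal $n\times n$ matrix with $\Theta_j>0$ for all $j$. Define $$H=\Theta^{-1}+A^{\mathsf T}A,\qquad P=\Theta^{-1}+\rho I_n.$$ Let $C$ be any positive constant and let $l=\#\{j\in\{1,\dots,n\}:\Theta_j^{-1}<C\}$. Suppose $A$ satisfies property P2 (see context) for $k=l$ with some constant $\delta_l>0$. If $A$ has orthonormal rows, i.e. $AA^{\mathsf T}=I_m$, then $$|\lambda-1|\le\delta_l+\frac14\,\frac{(3-\rho)^2}{\rho\,\delta_l\,C}\qquad\text{for every eigenvalue }\lambda\text{ of }P^{-1}H.$$ If $A$ has nearly orthonormal rows, i.e. satisfies property P1 (see context) with constant $\delta\ge 0$, then $$|\lambda-1|\le\delta_l+\frac14\,\frac{(1+\delta-\rho+2\sqrt{1+\delta})^2}{\rho\,\delta_l\,C}\qquad\text{for every eigenvalue }\lambda\text{ of }P^{-1}H.$$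
   Context: $I_k$ denotes the $k\times k$ identity matrix and $\|\cdot\|_2$ the spectral norm of a matrix. Property P1 with constant $\delta$ for $A\in\mathbb{R}^{m\times n}$: $\|AA^{\mathsf T}-I_m\|_2\le\delta$. Property P2 for $k$ with constant $\delta_k$ for $A\in\mathbb{R}^{m\times n}$: for every matrix $B$ composed of arbitrary $k$ (distinct) columns of $A$, $\left\|\frac{n}{m}B^{\mathsf T}B-I_k\right\|_2\le\delta_k$. (For $k=0$ the condition is vacuous.) *)

theory Defs
  imports
    Complex_Main
    "Jordan_Normal_Form.Matrix"
    "Jordan_Normal_Form.Char_Poly"
    "Jordan_Normal_Form.Gauss_Jordan_Elimination"
begin

definition eucl_norm :: "real vec \<Rightarrow> real" where
  "eucl_norm v = sqrt (v \<bullet> v)"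

(* The supremum is that of a nonempty set (it contains 0) which is bounded above by
   spec_norm_bdd_above below. An empty matrix has spectral norm 0. *)
definition spec_norm :: "real mat \<Rightarrow> real" where
  "spec_norm M = (SUP v\<in>{v \<in> carrier_vec (dim_col M). eucl_norm v \<le> 1}. eucl_norm (M *\<^sub>v v))"

definition property_P1 :: "real mat \<Rightarrow> real \<Rightarrow> bool" where
  "property_P1 A \<delta> \<longleftrightarrow> spec_norm (A * transpose_mat A - 1\<^sub>m (dim_row A)) \<le> \<delta>"

(* js lists the indices (counted from 0) of the k selected columns; these are pairwise
   distinct as indices, the columns themselves may coincide as vectors. *)
definition property_P2 :: "real mat \<Rightarrow> nat \<Rightarrow> real \<Rightarrow> bool" where
  "property_P2 A k \<delta>k \<longleftrightarrow> (k > 0 \<longrightarrow>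
     (\<forall>js. distinct js \<and> set js \<subseteq> {..<dim_col A} \<and> length js = k \<longrightarrow>
        (let B = mat_of_cols (dim_row A) (map (col A) js) in
           spec_norm ((real (dim_col A) / real (dim_row A)) \<cdot>\<^sub>m (transpose_mat B * B) - 1\<^sub>m k) \<le> \<delta>k)))"

(* Unspecified for a singular matrix; it is only applied to positive diagonal matrices,
   where mat_inv_mat_diag below shows it to be the expected inverse. *)
definition mat_inv :: "'a :: field mat \<Rightarrow> 'a mat" where
  "mat_inv M = the (mat_inverse M)"

lemma mat_inv_mat_diag:
  fixes f :: "nat \<Rightarrow> 'a :: field"
  assumes "\<And>i. i < n \<Longrightarrow> f i \<noteq> 0"
  shows "mat_inv (mat_diag n f) = mat_diag n (\<lambda>i. inverse (f i))"
proof -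
  let ?D = "mat_diag n f" and ?E = "mat_diag n (\<lambda>i. inverse (f i))"
  have DE: "?D * ?E = 1\<^sub>m n" and ED: "?E * ?D = 1\<^sub>m n"
    using assms by (simp_all, auto simp: mat_diag_def intro!: eq_matI)
  have U: "?D \<in> Units (ring_mat TYPE('a) n undefined)"
    using DE ED unfolding Units_def by (auto simp: ring_mat_def intro!: bexI[of _ ?E])
  have "mat_inverse ?D \<noteq> None"
    using mat_inverse(1)[OF mat_diag_dim] U by metis
  then obtain B where B: "mat_inverse ?D = Some B" by auto
  from mat_inverse(2)[OF mat_diag_dim B]
  have "B * ?D = 1\<^sub>m n" "B \<in> carrier_mat n n" by auto
  then have "B = B * (?D * ?E)" by (simp add: DE del: mat_diag_diag)
  also have "\<dots> = B * ?D * ?E"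
    using \<open>B \<in> carrier_mat n n\<close>
    by (intro assoc_mult_mat[symmetric, of B n n ?D n ?E n] mat_diag_dim)
  also have "\<dots> = ?E" using \<open>B * ?D = 1\<^sub>m n\<close> left_mult_one_mat[OF mat_diag_dim] by metis
  finally show ?thesis by (simp add: mat_inv_def B)
qed

lemma spec_norm_bdd_above:
  "bdd_above ((\<lambda>v. eucl_norm (M *\<^sub>v v)) ` {v \<in> carrier_vec (dim_col M). eucl_norm v \<le> 1})"
proof (rule bdd_aboveI2)
  fix v assume "v \<in> {v \<in> carrier_vec (dim_col M). eucl_norm v \<le> 1}"
  then have v: "v \<in> carrier_vec (dim_col M)" and n: "v \<bullet> v \<le> 1"
    by (auto simp: eucl_norm_def)
  have e: "\<bar>v $ j\<bar> \<le> 1" if "j < dim_col M" for j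
  proof -
    have "v $ j * v $ j \<le> (\<Sum>i = 0..<dim_col M. v $ i * v $ i)"
      using that by (intro member_le_sum[of j "{0..<dim_col M}" "\<lambda>i. v $ i * v $ i"]) auto
    also have "\<dots> \<le> 1" using n v by (simp add: scalar_prod_def)
    finally have "(v $ j)\<^sup>2 \<le> 1" by (simp add: power2_eq_square)
    then show ?thesis by (rule abs_square_le_1[THEN iffD1])
  qed
  have r: "\<bar>row M i \<bullet> v\<bar> \<le> (\<Sum>j<dim_col M. \<bar>M $$ (i, j)\<bar>)" if "i < dim_row M" for i
  proof -
    have "\<bar>row M i \<bullet> v\<bar> \<le> (\<Sum>j = 0..<dim_col M. \<bar>row M i $ j * v $ j\<bar>)"
      using v by (simp add: scalar_prod_def sum_abs)
    also have "\<dots> \<le> (\<Sum>j = 0..<dim_col M. \<bar>M $$ (i, j)\<bar>)"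
      using e that by (intro sum_mono) (auto simp: abs_mult intro: mult_left_le)
    finally show ?thesis by (simp add: lessThan_atLeast0)
  qed
  have "(M *\<^sub>v v) \<bullet> (M *\<^sub>v v) = (\<Sum>i = 0..<dim_row M. \<bar>row M i \<bullet> v\<bar>\<^sup>2)"
    by (simp add: scalar_prod_def[of "M *\<^sub>v v"] power2_eq_square)
  also have "\<dots> \<le> (\<Sum>i = 0..<dim_row M. (\<Sum>j<dim_col M. \<bar>M $$ (i, j)\<bar>)\<^sup>2)"
    using r by (intro sum_mono power_mono) auto
  finally show "eucl_norm (M *\<^sub>v v) \<le>
      sqrt (\<Sum>i = 0..<dim_row M. (\<Sum>j<dim_col M. \<bar>M $$ (i, j)\<bar>)\<^sup>2)"
    by (simp add: eucl_norm_def)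
qed

end

theory Submission
  imports Defs
begin

text \<open>
  If \<open>v = x + \<i> y\<close> is an eigenvector, then \<open>lam - 1\<close> is the quotient of
  \<open>q(x) + q(y)\<close> by \<open>E(x) + E(y)\<close>, where \<open>q(x) = |A x|^2 - \<rho> |x|^2\<close> and \<open>E(x) = x^T P x\<close>;
  so it suffices to bound \<open>|q(x)|\<close> by a multiple of \<open>E(x)\<close> for real \<open>x\<close>.
  Split \<open>x = x1 + x2\<close> orthogonally, \<open>x1\<close> being supported where the entries of \<open>\<Theta>^-1\<close> are below \<open>C\<close>.
  P1 bounds the eigenvalues of \<open>A^T A\<close> by \<open>\<mu> = 1 + \<delta>\<close>, so the Rayleigh quotients of \<open>A^T A\<close> at
  \<open>x\<close> and at \<open>x1\<close> differ by at most \<open>\<mu>\<close> times the sine \<open>|x2| / |x|\<close> of the angle between them,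
  and P2 says that the one at \<open>x1\<close> is within \<open>\<rho> \<delta>l\<close> of \<open>\<rho>\<close>. Hence
  \<open>|q(x)| \<le> \<rho> \<delta>l |x|^2 + \<mu> |x2| |x|\<close>. Since \<open>E(x) \<ge> \<rho> |x|^2 + C |x2|^2\<close>, AM-GM absorbs the cross term.
  This even gives the bound with \<open>\<mu>\<close> in place of \<open>\<mu> - \<rho> + 2 sqrt \<mu>\<close>.
\<close>

section \<open>Quadratic forms in two real variables\<close>

text \<open>Serves both as the source of Cauchy-Schwarz and as the bound on the mixed coefficient
  \<open>c\<close> below. Besides the two axes, one well-chosen point suffices.\<close>

lemma psd_form_discriminant:
  fixes p q r :: real
  assumes "\<And>u w. 0 \<le> p * u\<^sup>2 + 2 * q * u * w + r * w\<^sup>2"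
  shows "q\<^sup>2 \<le> p * r"
proof -
  have p: "0 \<le> p" using assms[of 1 0] by simp
  have r: "0 \<le> r" using assms[of 0 1] by simp
  show ?thesis
  proof (cases "r = 0")
    case True
    \<comment> \<open>At \<open>(- q, p + 1)\<close> the form equals \<open>- q^2 (p + 2)\<close>,
      which forces \<open>q = 0\<close>.\<close>
    have "0 \<le> - (q\<^sup>2 * (p + 2))"
      using assms[of "- q" "p + 1"] True by (simp add: algebra_simps power2_eq_square)
    moreover have "0 \<le> q\<^sup>2 * p" using p by simp
    ultimately have "q\<^sup>2 \<le> 0" unfolding distrib_left by linarith
    then show ?thesis using True by simp
  next
    case False
    \<comment> \<open>The value of the form at \<open>(r, - q)\<close>.\<close>
    have "0 \<le> r * (p * r - q\<^sup>2)"
      using assms[of r "- q"] by (simp add: algebra_simps power2_eq_square)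
    then show ?thesis using False r by (simp add: zero_le_mult_iff)
  qed
qed

text \<open>The left-hand side compares a form at two directions. It is controlled by the gap between
  the two eigenvalues of the form, at most \<open>\<mu>\<close>, times the sine of the angle between them.\<close>

lemma form_direction_gap:
  fixes s c d \<alpha> \<beta> \<mu> :: real
  assumes lb: "\<And>u w. 0 \<le> s * u\<^sup>2 + 2 * c * u * w + d * w\<^sup>2"
    and ub: "\<And>u w. s * u\<^sup>2 + 2 * c * u * w + d * w\<^sup>2 \<le> \<mu> * (\<alpha> * u\<^sup>2 + \<beta> * w\<^sup>2)"
    and \<alpha>: "\<alpha> > 0" and \<beta>: "\<beta> \<ge> 0"
  shows "\<bar>s + 2 * c + d - s / \<alpha> * (\<alpha> + \<beta>)\<bar> \<le> \<mu> * sqrt \<beta> * sqrt (\<alpha> + \<beta>)"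
proof -
  have c1: "c\<^sup>2 \<le> s * d" by (rule psd_form_discriminant[OF lb])
  \<comment> \<open>The complementary form, \<open>\<mu> (\<alpha> u^2 + \<beta> w^2)\<close> minus
    the given one, is nonnegative too; its mixed coefficient is \<open>- c\<close>.\<close>
  have c2: "(- c)\<^sup>2 \<le> (\<mu> * \<alpha> - s) * (\<mu> * \<beta> - d)"
    by (rule psd_form_discriminant) (use ub in \<open>simp add: algebra_simps\<close>)
  have s: "0 \<le> s" "s \<le> \<mu> * \<alpha>" using lb[of 1 0] ub[of 1 0] by simp_all
  have d: "0 \<le> d" "d \<le> \<mu> * \<beta>" using lb[of 0 1] ub[of 0 1] by simp_all
  have \<mu>: "0 \<le> \<mu>" using s \<alpha> by (smt (verit) mult_neg_pos)
  show ?thesis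
  proof (cases "\<beta> = 0")
    case True
    then show ?thesis using d c1 \<alpha> by auto
  next
    case False
    then have \<beta>: "\<beta> > 0" using \<beta> by simp
    define E where "E = d * \<alpha> - s * \<beta>"
    \<comment> \<open>In normalized coordinates the form has diagonal \<open>s / \<alpha>\<close>,
      \<open>d / \<beta>\<close> and mixed entry \<open>c / sqrt (\<alpha> \<beta>)\<close>; the
      left side is \<open>(\<alpha> \<beta>)^2\<close> times its squared eigenvalue gap. The gap of
      a nonnegative form is at most its trace. If the trace exceeds \<open>\<mu>\<close>, the
      complementary form has the same gap and trace below \<open>\<mu>\<close>.\<close>
    have gap: "E\<^sup>2 + 4 * c\<^sup>2 * \<alpha> * \<beta> \<le> (\<mu> * \<alpha> * \<beta>)\<^sup>2"
    proof (cases "d * \<alpha> + s * \<beta> \<le> \<mu> * \<alpha> * \<beta>")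
      case True
      have "E\<^sup>2 + 4 * c\<^sup>2 * \<alpha> * \<beta> \<le> E\<^sup>2 + 4 * (s * d) * \<alpha> * \<beta>"
        using c1 \<alpha> \<beta> by (simp add: mult_right_mono)
      also have "\<dots> = (d * \<alpha> + s * \<beta>)\<^sup>2" by (simp add: E_def algebra_simps power2_eq_square)
      also have "\<dots> \<le> (\<mu> * \<alpha> * \<beta>)\<^sup>2" using True s d \<alpha> \<beta> by (intro power_mono) auto
      finally show ?thesis .
    next
      case False
      have "E\<^sup>2 + 4 * c\<^sup>2 * \<alpha> * \<beta> \<le> E\<^sup>2 + 4 * ((\<mu> * \<alpha> - s) * (\<mu> * \<beta> - d)) * \<alpha> * \<beta>"
        using c2 \<alpha> \<beta> by (simp add: mult_right_mono)
      also have "\<dots> = ((\<mu> * \<beta> - d) * \<alpha> + (\<mu> * \<alpha> - s) * \<beta>)\<^sup>2"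
        by (simp add: E_def algebra_simps power2_eq_square)
      also have "\<dots> \<le> (\<mu> * \<alpha> * \<beta>)\<^sup>2"
        using False s d \<alpha> \<beta> by (intro power_mono add_nonneg_nonneg) (auto simp: algebra_simps)
      finally show ?thesis .
    qed
    \<comment> \<open>This square is exactly the defect in the Cauchy-Schwarz inequality that
      follows.\<close>
    have "0 \<le> \<alpha> * (E - 2 * \<beta> * c)\<^sup>2" using \<alpha> by simp
    then have "\<beta> * (E + 2 * c * \<alpha>)\<^sup>2 \<le> (\<alpha> + \<beta>) * (E\<^sup>2 + 4 * c\<^sup>2 * \<alpha> * \<beta>)"
      by (simp add: algebra_simps power2_eq_square)
    also have "\<dots> \<le> (\<alpha> + \<beta>) * (\<mu> * \<alpha> * \<beta>)\<^sup>2" using gap \<alpha> \<beta> by (intro mult_left_mono) auto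
    also have "\<dots> = \<beta> * (\<mu> * \<alpha> * sqrt \<beta> * sqrt (\<alpha> + \<beta>))\<^sup>2"
      using \<alpha> \<beta> by (simp add: power_mult_distrib algebra_simps power2_eq_square)
    finally have "(E + 2 * c * \<alpha>)\<^sup>2 \<le> (\<mu> * \<alpha> * sqrt \<beta> * sqrt (\<alpha> + \<beta>))\<^sup>2" using \<beta> by simp
    then have "\<bar>E + 2 * c * \<alpha>\<bar> \<le> \<mu> * \<alpha> * sqrt \<beta> * sqrt (\<alpha> + \<beta>)"
      using \<mu> \<alpha> \<beta> abs_le_square_iff[of "E + 2 * c * \<alpha>" "\<mu> * \<alpha> * sqrt \<beta> * sqrt (\<alpha> + \<beta>)"]
      by simp
    then have "\<bar>E + 2 * c * \<alpha>\<bar> / \<alpha> \<le> \<mu> * sqrt \<beta> * sqrt (\<alpha> + \<beta>)"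
      using \<alpha> by (simp add: field_simps)
    moreover have "s + 2 * c + d - s / \<alpha> * (\<alpha> + \<beta>) = (E + 2 * c * \<alpha>) / \<alpha>"
      using \<alpha> by (simp add: E_def field_simps)
    ultimately show ?thesis using \<alpha> by (simp add: abs_divide)
  qed
qed

text \<open>Here \<open>s\<close>, \<open>c\<close>, \<open>d\<close> stand for the inner products
  of \<open>A x1\<close> and \<open>A x2\<close>, and \<open>\<alpha>\<close>,
  \<open>\<beta>\<close> for \<open>|x1|^2\<close>, \<open>|x2|^2\<close>. Leaving \<open>g\<close>
  free lets both bounds of the theorem be instances.\<close>

lemma split_form_bound:
  fixes s c d \<alpha> \<beta> \<mu> \<rho> \<delta> g C :: real
  assumes lb: "\<And>u w. 0 \<le> s * u\<^sup>2 + 2 * c * u * w + d * w\<^sup>2"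
    and ub: "\<And>u w. s * u\<^sup>2 + 2 * c * u * w + d * w\<^sup>2 \<le> \<mu> * (\<alpha> * u\<^sup>2 + \<beta> * w\<^sup>2)"
    and \<alpha>: "\<alpha> \<ge> 0" and \<beta>: "\<beta> \<ge> 0"
    and s: "\<bar>s - \<rho> * \<alpha>\<bar> \<le> \<rho> * \<delta> * \<alpha>"
    and \<rho>: "0 < \<rho>" "\<rho> \<le> \<mu>" and g: "\<mu> \<le> g" and \<delta>: "\<delta> > 0" and C: "C > 0"
  shows "\<bar>s + 2 * c + d - \<rho> * (\<alpha> + \<beta>)\<bar> \<le>
           (\<delta> + 1/4 * (g\<^sup>2 / (\<rho> * \<delta> * C))) * (\<rho> * (\<alpha> + \<beta>) + C * \<beta>)"
proof -
  define r where "r = sqrt (\<alpha> + \<beta>)"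
  define b where "b = sqrt \<beta>"
  have r2: "r\<^sup>2 = \<alpha> + \<beta>" and b2: "b\<^sup>2 = \<beta>" and r0: "0 \<le> r" and b0: "0 \<le> b"
    using \<alpha> \<beta> by (simp_all add: r_def b_def)
  have main: "\<bar>s + 2 * c + d - \<rho> * (\<alpha> + \<beta>)\<bar> \<le> \<rho> * \<delta> * (\<alpha> + \<beta>) + \<mu> * b * r"
  \<comment> \<open>If \<open>x1\<close> vanishes there is no Rayleigh quotient at \<open>x1\<close>
    to compare with. Only \<open>d\<close> remains, and both \<open>d\<close> and
    \<open>\<rho> \<beta>\<close> lie between \<open>0\<close> and
    \<open>\<mu> \<beta>\<close>.\<close>
  proof (cases "\<alpha> = 0")
    case True
    then have s0: "s = 0" using s by simp
    have "c\<^sup>2 \<le> s * d" by (rule psd_form_discriminant[OF lb])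
    then have c0: "c = 0" using s0 by simp
    have d: "0 \<le> d" "d \<le> \<mu> * \<beta>" using lb[of 0 1] ub[of 0 1] by simp_all
    have br: "b * r = \<beta>" using True \<beta> by (simp add: b_def r_def)
    have "\<bar>d - \<rho> * \<beta>\<bar> \<le> \<mu> * \<beta>" using d \<rho> \<beta> by (smt (verit) mult_right_mono mult_nonneg_nonneg)
    moreover have "0 \<le> \<rho> * \<delta> * \<beta>" using \<rho> \<delta> \<beta> by simp
    ultimately show ?thesis using True s0 c0 br by (simp add: mult.assoc)
  next
    case False
    then have \<alpha>: "\<alpha> > 0" using \<alpha> by simp
    have 1: "\<bar>s + 2 * c + d - s / \<alpha> * (\<alpha> + \<beta>)\<bar> \<le> \<mu> * b * r"
      unfolding b_def r_def by (rule form_direction_gap[OF lb ub \<alpha> \<beta>])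
    have "\<bar>s / \<alpha> - \<rho>\<bar> = \<bar>s - \<rho> * \<alpha>\<bar> / \<alpha>" using \<alpha> by (simp add: field_simps abs_divide[symmetric])
    also have "\<dots> \<le> \<rho> * \<delta>" using s \<alpha> by (simp add: field_simps)
    finally have "\<bar>s / \<alpha> - \<rho>\<bar> * (\<alpha> + \<beta>) \<le> \<rho> * \<delta> * (\<alpha> + \<beta>)"
      using \<alpha> \<beta> by (intro mult_right_mono) auto
    then have 2: "\<bar>s / \<alpha> * (\<alpha> + \<beta>) - \<rho> * (\<alpha> + \<beta>)\<bar> \<le> \<rho> * \<delta> * (\<alpha> + \<beta>)"
      unfolding left_diff_distrib[symmetric] abs_mult using \<alpha> \<beta> by simp
    have "\<bar>a - Y\<bar> \<le> q + p" if "\<bar>a - X\<bar> \<le> p" "\<bar>X - Y\<bar> \<le> q" for a p q X Y :: real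
      using that by linarith
    from this[OF 1 2] show ?thesis .
  qed
  have "\<mu> * b * r \<le> g * b * r" using g b0 r0 by (intro mult_right_mono) auto
  also have "\<dots> \<le> (g * r)\<^sup>2 / (4 * \<delta> * C) + \<delta> * C * b\<^sup>2"
  proof -
    \<comment> \<open>The AM-GM weights are chosen so that the \<open>b^2\<close> term becomes
      \<open>\<delta>\<close> times the energy \<open>C \<beta>\<close>.\<close>
    have "0 \<le> (g * r - 2 * \<delta> * C * b)\<^sup>2 / (4 * \<delta> * C)" using \<delta> C by simp
    also have "\<dots> = (g * r)\<^sup>2 / (4 * \<delta> * C) + \<delta> * C * b\<^sup>2 - g * b * r"
      using \<delta> C by (simp add: field_simps power2_eq_square)
    finally show ?thesis by simp
  qed
  \<comment> \<open>A nonnegative term is added so that the \<open>g^2\<close> coefficient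
    multiplies the whole energy \<open>\<rho> (\<alpha> + \<beta>) + C \<beta>\<close>.\<close>
  also have "\<dots> \<le> (g * r)\<^sup>2 / (4 * \<delta> * C) + \<delta> * C * b\<^sup>2 + 1/4 * (g\<^sup>2 / (\<rho> * \<delta> * C)) * (C * \<beta>)"
    using \<rho> \<delta> C \<beta> by simp
  also have "\<dots> = 1/4 * (g\<^sup>2 / (\<rho> * \<delta> * C)) * (\<rho> * (\<alpha> + \<beta>) + C * \<beta>) + \<delta> * C * \<beta>"
    using \<rho> \<delta> C by (simp add: power_mult_distrib r2 b2 divide_simps) (simp add: algebra_simps)
  finally show ?thesis using main by (simp add: algebra_simps)
qed

section \<open>Euclidean norm and spectral norm\<close>

lemma scalar_prod_self_nonneg: "0 \<le> v \<bullet> v" for v :: "real vec"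
  by (simp add: scalar_prod_def sum_nonneg)

lemma eucl_norm_sq: "(eucl_norm v)\<^sup>2 = v \<bullet> v"
  using scalar_prod_self_nonneg[of v] by (simp add: eucl_norm_def)

lemma eucl_norm_nonneg: "0 \<le> eucl_norm v"
  using scalar_prod_self_nonneg[of v] by (simp add: eucl_norm_def)

text \<open>Cauchy-Schwarz, as the discriminant condition for the form \<open>|x v + y w|^2\<close>
  in \<open>x\<close> and \<open>y\<close>.\<close>

lemma scalar_prod_le_eucl_norm:
  assumes "v \<in> carrier_vec n" "w \<in> carrier_vec n"
  shows "\<bar>v \<bullet> w\<bar> \<le> eucl_norm v * eucl_norm w"
proof -
  have "(v \<bullet> w)\<^sup>2 \<le> (v \<bullet> v) * (w \<bullet> w)"
  proof (rule psd_form_discriminant)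
    fix x y :: real
    have "0 \<le> (x \<cdot>\<^sub>v v + y \<cdot>\<^sub>v w) \<bullet> (x \<cdot>\<^sub>v v + y \<cdot>\<^sub>v w)" by (rule scalar_prod_self_nonneg)
    also have "\<dots> = (v \<bullet> v) * x\<^sup>2 + 2 * (v \<bullet> w) * x * y + (w \<bullet> w) * y\<^sup>2"
      using assms by (simp add: scalar_prod_add_distrib[of _ n] add_scalar_prod_distrib[of _ n]
          comm_scalar_prod[of w n v] power2_eq_square algebra_simps)
    finally show "0 \<le> (v \<bullet> v) * x\<^sup>2 + 2 * (v \<bullet> w) * x * y + (w \<bullet> w) * y\<^sup>2" .
  qed
  also have "\<dots> = (eucl_norm v * eucl_norm w)\<^sup>2" by (simp add: power_mult_distrib eucl_norm_sq)
  finally show ?thesis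
    using abs_le_square_iff[of "v \<bullet> w" "eucl_norm v * eucl_norm w"]
    by (simp add: eucl_norm_nonneg)
qed

lemma eucl_norm_smult: "eucl_norm (k \<cdot>\<^sub>v v) = \<bar>k\<bar> * eucl_norm v"
proof -
  have "(k \<cdot>\<^sub>v v) \<bullet> (k \<cdot>\<^sub>v v) = k\<^sup>2 * (v \<bullet> v)"
    using scalar_prod_smult_right[of v "k \<cdot>\<^sub>v v" k] by (simp add: power2_eq_square)
  then show ?thesis by (simp add: eucl_norm_def real_sqrt_mult)
qed

text \<open>A nonzero \<open>v\<close> is rescaled into the unit ball, where the supremum, finite by
  \<open>spec_norm_bdd_above\<close>, applies.\<close>

lemma eucl_norm_mult_le_spec_norm:
  assumes "M \<in> carrier_mat nr nc" "v \<in> carrier_vec nc"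
  shows "eucl_norm (M *\<^sub>v v) \<le> spec_norm M * eucl_norm v"
proof (cases "eucl_norm v = 0")
  case True
  then have "v \<bullet> v = 0" by (metis eucl_norm_sq power_zero_numeral)
  then have "v = 0\<^sub>v nc"
    using assms by (auto simp: scalar_prod_def sum_nonneg_eq_0_iff intro!: eq_vecI)
  moreover have "M *\<^sub>v 0\<^sub>v nc = 0\<^sub>v nr" using assms by (intro eq_vecI) auto
  ultimately show ?thesis by (simp add: eucl_norm_def)
next
  case False
  then have pos: "eucl_norm v > 0" using eucl_norm_nonneg[of v] by simp
  let ?w = "(1 / eucl_norm v) \<cdot>\<^sub>v v"
  have "eucl_norm (M *\<^sub>v ?w) \<le> spec_norm M"
    unfolding spec_norm_def
    by (rule cSUP_upper[OF _ spec_norm_bdd_above]) (use assms pos in \<open>simp add: eucl_norm_smult\<close>)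
  moreover have "M *\<^sub>v ?w = (1 / eucl_norm v) \<cdot>\<^sub>v (M *\<^sub>v v)"
    using assms by (simp add: mult_mat_vec)
  ultimately show ?thesis using pos by (simp add: eucl_norm_smult field_simps)
qed

lemma form_le_spec_norm:
  assumes "M \<in> carrier_mat n n" "v \<in> carrier_vec n"
  shows "\<bar>v \<bullet> (M *\<^sub>v v)\<bar> \<le> spec_norm M * (v \<bullet> v)"
proof -
  have "\<bar>v \<bullet> (M *\<^sub>v v)\<bar> \<le> eucl_norm v * eucl_norm (M *\<^sub>v v)"
    using assms by (intro scalar_prod_le_eucl_norm[of _ n]) auto
  also have "\<dots> \<le> eucl_norm v * (spec_norm M * eucl_norm v)"
    using assms by (intro mult_left_mono eucl_norm_mult_le_spec_norm eucl_norm_nonneg)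
  also have "\<dots> = spec_norm M * (v \<bullet> v)"
    by (simp add: eucl_norm_sq[symmetric] power2_eq_square)
  finally show ?thesis .
qed

section \<open>What P1 and P2 say about \<open>|A x|^2\<close>\<close>

text \<open>P1 concerns \<open>A A^T\<close>, while the bound concerns \<open>A^T A\<close>. With
  \<open>y = A x\<close> and \<open>z = A^T y\<close>, P1 gives
  \<open>|z|^2 \<le> (1 + \<delta>) |y|^2\<close>, and \<open>|y|^2 = z . x\<close> with
  Cauchy-Schwarz gives \<open>|y|^4 \<le> |z|^2 |x|^2\<close>; then \<open>|y|^2\<close>
  cancels.\<close>

lemma gram_form_le_property_P1:
  assumes A: "A \<in> carrier_mat m n" and x: "x \<in> carrier_vec n"
    and P1: "property_P1 A \<delta>" and \<delta>: "\<delta> \<ge> 0"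
  shows "(A *\<^sub>v x) \<bullet> (A *\<^sub>v x) \<le> (1 + \<delta>) * (x \<bullet> x)"
proof -
  define y where "y = A *\<^sub>v x"
  define z where "z = transpose_mat A *\<^sub>v y"
  let ?G = "A * transpose_mat A"
  have y: "y \<in> carrier_vec m" and z: "z \<in> carrier_vec n" using A x by (auto simp: y_def z_def)
  have "z \<bullet> z = y \<bullet> (A *\<^sub>v z)"
    using transpose_vec_mult_scalar[OF A z y] by (simp add: z_def)
  also have "A *\<^sub>v z = ?G *\<^sub>v y" using A y by (simp add: z_def assoc_mult_mat_vec[of _ m n _ m])
  also have "\<dots> = (?G - 1\<^sub>m m) *\<^sub>v y + y"
    using A y by (intro eq_vecI) (auto simp: minus_mult_distrib_mat_vec[of _ m m])
  also have "y \<bullet> \<dots> = y \<bullet> ((?G - 1\<^sub>m m) *\<^sub>v y) + y \<bullet> y"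
    using A y by (intro scalar_prod_add_distrib[of _ m]) (auto intro!: carrier_vecI)
  also have "y \<bullet> ((?G - 1\<^sub>m m) *\<^sub>v y) \<le> spec_norm (?G - 1\<^sub>m m) * (y \<bullet> y)"
    using form_le_spec_norm[of "?G - 1\<^sub>m m" m y] A y by (auto simp: abs_le_iff minus_carrier_mat)
  also have "\<dots> \<le> \<delta> * (y \<bullet> y)"
    using P1 A by (intro mult_right_mono scalar_prod_self_nonneg) (simp add: property_P1_def)
  finally have zz: "z \<bullet> z \<le> (1 + \<delta>) * (y \<bullet> y)" by (simp add: algebra_simps)
  have "y \<bullet> y = z \<bullet> x"
    using transpose_vec_mult_scalar[OF A x y] by (simp add: y_def z_def)
  then have "(y \<bullet> y)\<^sup>2 = \<bar>z \<bullet> x\<bar>\<^sup>2" by simp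
  also have "\<dots> \<le> (eucl_norm z * eucl_norm x)\<^sup>2"
    using scalar_prod_le_eucl_norm[OF z x] by (intro power_mono) auto
  also have "\<dots> = (z \<bullet> z) * (x \<bullet> x)" by (simp add: power_mult_distrib eucl_norm_sq)
  also have "\<dots> \<le> (1 + \<delta>) * (y \<bullet> y) * (x \<bullet> x)"
    using zz by (intro mult_right_mono scalar_prod_self_nonneg)
  finally have *: "(y \<bullet> y) * (y \<bullet> y) \<le> (y \<bullet> y) * ((1 + \<delta>) * (x \<bullet> x))"
    by (simp add: power2_eq_square algebra_simps)
  show ?thesis
  proof (cases "y \<bullet> y = 0")
    case True
    then show ?thesis using \<delta> scalar_prod_self_nonneg[of x] by (simp add: y_def)
  next
    case False
    then have "y \<bullet> y > 0" using scalar_prod_self_nonneg[of y] by simp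
    with * show ?thesis by (simp add: y_def)
  qed
qed

text \<open>Makes the orthonormal case the instance \<open>\<delta> = 0\<close> of the general
  bound.\<close>

lemma property_P1_orthonormal:
  assumes "A \<in> carrier_mat m n" "A * transpose_mat A = 1\<^sub>m m"
  shows "property_P1 A 0"
proof -
  have "eucl_norm (0\<^sub>m m m *\<^sub>v v) = 0" if "v \<in> carrier_vec m" for v :: "real vec"
  proof -
    have "0\<^sub>m m m *\<^sub>v v = 0\<^sub>v m" using that by (intro eq_vecI) auto
    then show ?thesis by (simp add: eucl_norm_def)
  qed
  then have "spec_norm (0\<^sub>m m m) \<le> 0"
    unfolding spec_norm_def
    by (intro cSUP_least) (auto simp: eucl_norm_def intro!: exI[of _ "0\<^sub>v m"])
  moreover have "A * transpose_mat A - 1\<^sub>m (dim_row A) = 0\<^sub>m m m"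
    using assms by (auto intro!: eq_matI)
  ultimately show ?thesis by (simp add: property_P1_def)
qed

text \<open>For \<open>x\<close> supported on \<open>S\<close>, \<open>A x = B z\<close>, where
  \<open>B\<close> collects the columns indexed by \<open>S\<close> and \<open>z\<close> the
  matching entries of \<open>x\<close>. P2 bounds the form of \<open>(n / m) B^T B - I\<close> at
  \<open>z\<close>, and multiplying by \<open>m / n\<close> gives the claim.\<close>

lemma property_P2_gram_form:
  assumes A: "A \<in> carrier_mat m n" and x: "x \<in> carrier_vec n"
    and m: "m > 0" and n: "n > 0"
    and P2: "property_P2 A (card S) \<delta>" and S: "S \<subseteq> {..<n}"
    and supp: "\<And>j. j < n \<Longrightarrow> j \<notin> S \<Longrightarrow> x $ j = 0"
  shows "\<bar>(A *\<^sub>v x) \<bullet> (A *\<^sub>v x) - real m / real n * (x \<bullet> x)\<bar> \<le> real m / real n * \<delta> * (x \<bullet> x)"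
\<comment> \<open>P2 is vacuous for \<open>k = 0\<close>, but then \<open>x\<close> is zero.\<close>
proof (cases "S = {}")
  case True
  then have "x = 0\<^sub>v n" using x supp by (intro eq_vecI) auto
  moreover have "A *\<^sub>v 0\<^sub>v n = 0\<^sub>v m" using A by (intro eq_vecI) auto
  ultimately show ?thesis by simp
next
  case False
  have fin: "finite S" using S finite_subset by blast
  define l where "l = card S"
  define js where "js = sorted_list_of_set S"
  have js: "distinct js" "set js = S" "length js = l" using fin by (auto simp: js_def l_def)
  define B where "B = mat_of_cols m (map (col A) js)"
  define z where "z = vec l (\<lambda>i. x $ (js ! i))"
  have B: "B \<in> carrier_mat m l" using js by (simp add: B_def mat_of_cols_def)
  have z: "z \<in> carrier_vec l" by (simp add: z_def)
  have reindex: "(\<Sum>i = 0..<l. f (js ! i)) = (\<Sum>j = 0..<n. f j)"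
    if "\<And>j. j < n \<Longrightarrow> j \<notin> S \<Longrightarrow> f j = 0" for f :: "nat \<Rightarrow> real"
  proof -
    have "(\<Sum>i = 0..<l. f (js ! i)) = (\<Sum>j\<in>S. f j)"
      by (rule sum.reindex_bij_betw[OF bij_betw_nth]) (use js in auto)
    also have "\<dots> = (\<Sum>j = 0..<n. f j)"
      using S that by (intro sum.mono_neutral_left) auto
    finally show ?thesis .
  qed
  have js_lt: "js ! i < n" if "i < l" for i using that js S nth_mem[of i js] by auto
  have zz: "z \<bullet> z = x \<bullet> x"
    using reindex[of "\<lambda>j. x $ j * x $ j"] supp x by (simp add: scalar_prod_def z_def)
  have Bz: "B *\<^sub>v z = A *\<^sub>v x"
  proof (rule eq_vecI)
    fix k assume "k < dim_vec (A *\<^sub>v x)"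
    then have k: "k < m" using A by simp
    have "(B *\<^sub>v z) $ k = (\<Sum>i = 0..<l. A $$ (k, js ! i) * x $ (js ! i))"
      using k A B js js_lt by (auto simp: scalar_prod_def z_def B_def mat_of_cols_def intro!: sum.cong)
    also have "\<dots> = (\<Sum>j = 0..<n. A $$ (k, j) * x $ j)" using supp by (intro reindex) simp
    also have "\<dots> = (A *\<^sub>v x) $ k" using k A x by (simp add: scalar_prod_def)
    finally show "(B *\<^sub>v z) $ k = (A *\<^sub>v x) $ k" .
  qed (use A B in simp)
  define M where "M = (real n / real m) \<cdot>\<^sub>m (transpose_mat B * B) - 1\<^sub>m l"
  have M: "M \<in> carrier_mat l l" using B by (auto simp: M_def intro!: carrier_matI)
  have "l > 0" using False fin by (simp add: l_def card_gt_0_iff)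
  then have spec: "spec_norm M \<le> \<delta>"
    using P2 js S A unfolding property_P2_def l_def[symmetric] M_def B_def
    by (auto simp: Let_def)
  have "M *\<^sub>v z = (real n / real m) \<cdot>\<^sub>v (transpose_mat B *\<^sub>v (B *\<^sub>v z)) - z"
  proof -
    have BB: "transpose_mat B * B \<in> carrier_mat l l" using B by simp
    then have "M *\<^sub>v z = ((real n / real m) \<cdot>\<^sub>m (transpose_mat B * B)) *\<^sub>v z - z"
      using z by (simp add: M_def minus_mult_distrib_mat_vec[of _ l l])
    also have "((real n / real m) \<cdot>\<^sub>m (transpose_mat B * B)) *\<^sub>v z
        = (real n / real m) \<cdot>\<^sub>v (transpose_mat B * B *\<^sub>v z)"
      using BB z by (intro eq_vecI) auto
    also have "transpose_mat B * B *\<^sub>v z = transpose_mat B *\<^sub>v (B *\<^sub>v z)"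
      using B z by (intro assoc_mult_mat_vec[of _ l m _ l]) auto
    finally show ?thesis .
  qed
  then have "z \<bullet> (M *\<^sub>v z) = real n / real m * (z \<bullet> (transpose_mat B *\<^sub>v (B *\<^sub>v z))) - z \<bullet> z"
    using B z by (simp add: scalar_prod_minus_distrib[of _ l])
  also have "z \<bullet> (transpose_mat B *\<^sub>v (B *\<^sub>v z)) = (B *\<^sub>v z) \<bullet> (B *\<^sub>v z)"
    using transpose_vec_mult_scalar[OF B z, of "B *\<^sub>v z"] B z
    by (simp add: comm_scalar_prod[of z l])
  finally have "\<bar>real n / real m * ((A *\<^sub>v x) \<bullet> (A *\<^sub>v x)) - x \<bullet> x\<bar> \<le> spec_norm M * (x \<bullet> x)"
    using form_le_spec_norm[OF M z] by (simp add: Bz zz)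
  also have "\<dots> \<le> \<delta> * (x \<bullet> x)" using spec by (intro mult_right_mono scalar_prod_self_nonneg)
  finally have "real m / real n * \<bar>real n / real m * ((A *\<^sub>v x) \<bullet> (A *\<^sub>v x)) - x \<bullet> x\<bar>
      \<le> real m / real n * (\<delta> * (x \<bullet> x))"
    by (intro mult_left_mono) auto
  moreover have "real m / real n * \<bar>real n / real m * ((A *\<^sub>v x) \<bullet> (A *\<^sub>v x)) - x \<bullet> x\<bar>
      = \<bar>real m / real n * (real n / real m * ((A *\<^sub>v x) \<bullet> (A *\<^sub>v x)) - x \<bullet> x)\<bar>"
    by (simp only: abs_mult) simp
  ultimately show ?thesis using m n by (simp add: right_diff_distrib mult.assoc)
qed

section \<open>Deviation of \<open>|A x|^2\<close> from \<open>\<rho> |x|^2\<close> for real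
  \<open>x\<close>\<close>

text \<open>The sum on the right is \<open>x^T P x\<close>. The split of \<open>x\<close> along
  \<open>S\<close> turns P1 into a bound on all combinations of \<open>x1\<close> and
  \<open>x2\<close>, and P2 into a bound at \<open>x1\<close> alone.\<close>

lemma gram_form_deviation:
  fixes \<rho> C \<delta> \<delta>l :: real and \<theta> :: "nat \<Rightarrow> real"
  assumes A: "A \<in> carrier_mat m n" and x: "x \<in> carrier_vec n"
    and m: "m > 0" and n: "n > 0" and \<rho>: "\<rho> = real m / real n" and \<rho>1: "\<rho> \<le> 1"
    and \<theta>: "\<And>j. j < n \<Longrightarrow> \<theta> j > 0" and C: "C > 0" and \<delta>l: "\<delta>l > 0"
    and P2: "property_P2 A (card {j. j < n \<and> inverse (\<theta> j) < C}) \<delta>l"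
    and P1: "property_P1 A \<delta>" and \<delta>: "\<delta> \<ge> 0" and g: "1 + \<delta> \<le> g"
  shows "\<bar>(A *\<^sub>v x) \<bullet> (A *\<^sub>v x) - \<rho> * (x \<bullet> x)\<bar> \<le>
    (\<delta>l + 1/4 * (g\<^sup>2 / (\<rho> * \<delta>l * C))) * (\<Sum>j<n. (inverse (\<theta> j) + \<rho>) * (x $ j)\<^sup>2)"
proof -
  define S where "S = {j. j < n \<and> inverse (\<theta> j) < C}"
  define x1 where "x1 = vec n (\<lambda>j. if j \<in> S then x $ j else 0)"
  define x2 where "x2 = vec n (\<lambda>j. if j \<in> S then 0 else x $ j)"
  have x1: "x1 \<in> carrier_vec n" and x2: "x2 \<in> carrier_vec n" by (auto simp: x1_def x2_def)
  have xsum: "x = x1 + x2" using x by (intro eq_vecI) (auto simp: x1_def x2_def)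
  define s where "s = (A *\<^sub>v x1) \<bullet> (A *\<^sub>v x1)"
  define c where "c = (A *\<^sub>v x1) \<bullet> (A *\<^sub>v x2)"
  define d where "d = (A *\<^sub>v x2) \<bullet> (A *\<^sub>v x2)"
  have orth: "x1 \<bullet> x2 = 0" by (auto simp: scalar_prod_def x1_def x2_def intro!: sum.neutral)
  have form: "(A *\<^sub>v (u \<cdot>\<^sub>v x1 + w \<cdot>\<^sub>v x2)) \<bullet> (A *\<^sub>v (u \<cdot>\<^sub>v x1 + w \<cdot>\<^sub>v x2))
      = s * u\<^sup>2 + 2 * c * u * w + d * w\<^sup>2" for u w
  proof -
    have c: "A *\<^sub>v x1 \<in> carrier_vec m" "A *\<^sub>v x2 \<in> carrier_vec m" using A x1 x2 by auto
    have "A *\<^sub>v (u \<cdot>\<^sub>v x1 + w \<cdot>\<^sub>v x2) = u \<cdot>\<^sub>v (A *\<^sub>v x1) + w \<cdot>\<^sub>v (A *\<^sub>v x2)"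
      using A x1 x2 by (simp add: mult_add_distrib_mat_vec[of _ m n] mult_mat_vec[of _ m n])
    then show ?thesis using c
      by (simp add: s_def c_def d_def scalar_prod_add_distrib[of _ m] add_scalar_prod_distrib[of _ m]
          comm_scalar_prod[of "A *\<^sub>v x2" m "A *\<^sub>v x1"] power2_eq_square algebra_simps)
  qed
  have norm: "(u \<cdot>\<^sub>v x1 + w \<cdot>\<^sub>v x2) \<bullet> (u \<cdot>\<^sub>v x1 + w \<cdot>\<^sub>v x2) = (x1 \<bullet> x1) * u\<^sup>2 + (x2 \<bullet> x2) * w\<^sup>2" for u w
    using x1 x2 orth
    by (simp add: scalar_prod_add_distrib[of _ n] add_scalar_prod_distrib[of _ n]
        comm_scalar_prod[of x2 n x1] power2_eq_square algebra_simps)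
  have "\<bar>s + 2 * c + d - \<rho> * (x1 \<bullet> x1 + x2 \<bullet> x2)\<bar> \<le>
      (\<delta>l + 1/4 * (g\<^sup>2 / (\<rho> * \<delta>l * C))) * (\<rho> * (x1 \<bullet> x1 + x2 \<bullet> x2) + C * (x2 \<bullet> x2))"
  proof (rule split_form_bound)
    show "0 \<le> s * u\<^sup>2 + 2 * c * u * w + d * w\<^sup>2" for u w
      unfolding form[symmetric] by (rule scalar_prod_self_nonneg)
    show "s * u\<^sup>2 + 2 * c * u * w + d * w\<^sup>2 \<le> (1 + \<delta>) * (x1 \<bullet> x1 * u\<^sup>2 + x2 \<bullet> x2 * w\<^sup>2)" for u w
      unfolding form[symmetric] norm[symmetric]
      using x1 x2 by (intro gram_form_le_property_P1[OF A _ P1 \<delta>]) auto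
    show "\<bar>s - \<rho> * (x1 \<bullet> x1)\<bar> \<le> \<rho> * \<delta>l * (x1 \<bullet> x1)"
      unfolding s_def \<rho> by (rule property_P2_gram_form[OF A x1 m n P2]) (auto simp: x1_def S_def)
    show "0 < \<rho>" using m n \<rho> by simp
    show "\<rho> \<le> 1 + \<delta>" using \<rho>1 \<delta> by simp
  qed (use scalar_prod_self_nonneg g \<delta>l C in auto)
  moreover have "(A *\<^sub>v x) \<bullet> (A *\<^sub>v x) = s + 2 * c + d" "x \<bullet> x = x1 \<bullet> x1 + x2 \<bullet> x2"
    using form[of 1 1] norm[of 1 1] x1 x2 by (auto simp: xsum)
  \<comment> \<open>Termwise: off \<open>S\<close> the entry of \<open>\<Theta>^-1\<close> is at
    least \<open>C\<close>, on \<open>S\<close> it is positive.\<close>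
  moreover have "\<rho> * (x \<bullet> x) + C * (x2 \<bullet> x2) \<le> (\<Sum>j<n. (inverse (\<theta> j) + \<rho>) * (x $ j)\<^sup>2)"
  proof -
    have "\<rho> * (x \<bullet> x) + C * (x2 \<bullet> x2)
        = (\<Sum>j<n. \<rho> * (x $ j)\<^sup>2 + C * (if j \<in> S then 0 else (x $ j)\<^sup>2))"
      using x by (simp add: scalar_prod_def x2_def sum.distrib sum_distrib_left power2_eq_square
          lessThan_atLeast0 cong: if_cong) (auto intro!: sum.cong)
    also have "\<dots> \<le> (\<Sum>j<n. (inverse (\<theta> j) + \<rho>) * (x $ j)\<^sup>2)"
    proof (rule sum_mono)
      fix j assume "j \<in> {..<n}"
      then have "inverse (\<theta> j) > 0" "j \<notin> S \<Longrightarrow> C \<le> inverse (\<theta> j)"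
        using \<theta>[of j] by (auto simp: S_def)
      then show "\<rho> * (x $ j)\<^sup>2 + C * (if j \<in> S then 0 else (x $ j)\<^sup>2)
          \<le> (inverse (\<theta> j) + \<rho>) * (x $ j)\<^sup>2"
        by (auto simp: distrib_right mult_right_mono)
    qed
    finally show ?thesis .
  qed
  moreover have "0 \<le> \<delta>l + 1/4 * (g\<^sup>2 / (\<rho> * \<delta>l * C))"
    using \<delta>l C m n by (simp add: \<rho>)
  ultimately show ?thesis by (smt (verit, best) mult_left_mono)
qed

section \<open>Complex eigenvectors of the preconditioned matrix\<close>

text \<open>The hypothesis is \<open>A^T A v = (\<mu> P + \<rho> I) v\<close> with \<open>P\<close>
  the diagonal matrix of \<open>p\<close>. Row \<open>i\<close> is multiplied by the conjugate of
  \<open>v $ i\<close> and the rows are summed; since \<open>A\<close> is real,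
  \<open>|A v|^2\<close> splits into the parts from \<open>x\<close> and \<open>y\<close>.\<close>

lemma gram_rayleigh_complex:
  fixes v :: "complex vec" and p :: "nat \<Rightarrow> real" and \<mu> :: complex and \<rho> :: real
  assumes A: "A \<in> carrier_mat m n" and v: "v \<in> carrier_vec n"
    and eq: "\<And>i. i < n \<Longrightarrow>
      (\<Sum>j<n. of_real ((transpose_mat A * A) $$ (i, j)) * v $ j) = (\<mu> * of_real (p i) + of_real \<rho>) * v $ i"
  defines "x \<equiv> map_vec Re v" and "y \<equiv> map_vec Im v"
  shows "of_real ((A *\<^sub>v x) \<bullet> (A *\<^sub>v x) + (A *\<^sub>v y) \<bullet> (A *\<^sub>v y) - \<rho> * (x \<bullet> x + y \<bullet> y))
    = \<mu> * of_real ((\<Sum>j<n. p j * (x $ j)\<^sup>2) + (\<Sum>j<n. p j * (y $ j)\<^sup>2))"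
proof -
  have xy: "x \<in> carrier_vec n" "y \<in> carrier_vec n" using v by (auto simp: x_def y_def)
  define a where "a k j = complex_of_real (A $$ (k, j))" for k j
  define w where "w k = (\<Sum>j<n. a k j * v $ j)" for k
  have G: "of_real ((transpose_mat A * A) $$ (i, j)) = (\<Sum>k<m. a k i * a k j)"
    if "i < n" "j < n" for i j
    using that A by (simp add: scalar_prod_def a_def lessThan_atLeast0)
  have w: "Re (w k) = (A *\<^sub>v x) $ k" "Im (w k) = (A *\<^sub>v y) $ k" if "k < m" for k
    using that A v by (auto simp: w_def a_def scalar_prod_def x_def y_def lessThan_atLeast0 intro!: sum.cong)
  have sq: "cnj z * z = of_real ((Re z)\<^sup>2 + (Im z)\<^sup>2)" for z
    by (simp add: complex_mult_cnj mult.commute)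
  have v_sq: "cnj (v $ i) * v $ i = of_real ((x $ i)\<^sup>2 + (y $ i)\<^sup>2)" if "i < n" for i
    using that v by (simp add: sq x_def y_def)
  \<comment> \<open>\<open>w\<close> is \<open>A v\<close>. Its squared norm is expanded and
    reordered until the inner sum is row \<open>i\<close> of \<open>A^T A v\<close>.\<close>
  have "(\<Sum>k<m. cnj (w k) * w k) = (\<Sum>k<m. \<Sum>i<n. \<Sum>j<n. cnj (v $ i) * (a k i * a k j * v $ j))"
    by (simp add: w_def a_def sum_product) (simp add: mult_ac)
  also have "\<dots> = (\<Sum>i<n. \<Sum>k<m. \<Sum>j<n. cnj (v $ i) * (a k i * a k j * v $ j))"
    by (rule sum.swap)
  also have "\<dots> = (\<Sum>i<n. \<Sum>j<n. \<Sum>k<m. cnj (v $ i) * (a k i * a k j * v $ j))"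
    by (intro sum.cong refl sum.swap)
  also have "\<dots> = (\<Sum>i<n. cnj (v $ i) * (\<Sum>j<n. of_real ((transpose_mat A * A) $$ (i, j)) * v $ j))"
    by (intro sum.cong refl) (simp add: G sum_distrib_left sum_distrib_right del: index_mult_mat)
  also have "\<dots> = (\<Sum>i<n. (\<mu> * of_real (p i) + of_real \<rho>) * (cnj (v $ i) * v $ i))"
    by (intro sum.cong refl) (simp add: eq del: index_mult_mat)
  also have "\<dots> = (\<Sum>i<n. (\<mu> * of_real (p i) + of_real \<rho>) * of_real ((x $ i)\<^sup>2 + (y $ i)\<^sup>2))"
    by (intro sum.cong refl) (simp add: v_sq)
  also have "\<dots> = \<mu> * of_real ((\<Sum>j<n. p j * (x $ j)\<^sup>2) + (\<Sum>j<n. p j * (y $ j)\<^sup>2))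
      + of_real (\<rho> * (x \<bullet> x + y \<bullet> y))"
    using xy by (simp add: scalar_prod_def lessThan_atLeast0 sum_distrib_left sum.distrib
        algebra_simps power2_eq_square)
  finally have *: "(\<Sum>k<m. cnj (w k) * w k) = \<dots>" .
  have "(\<Sum>k<m. cnj (w k) * w k) = of_real ((A *\<^sub>v x) \<bullet> (A *\<^sub>v x) + (A *\<^sub>v y) \<bullet> (A *\<^sub>v y))"
    using A by (simp add: sq w scalar_prod_def[of "A *\<^sub>v _"] lessThan_atLeast0 sum.distrib power2_eq_square
        del: index_mult_mat_vec)
  with * show ?thesis by simp
qed

text \<open>\<open>lam\<close> is taken complex because \<open>P^-1 H\<close> need not be symmetric.
  The equation \<open>H v = lam P v\<close> becomes
  \<open>A^T A v = ((lam - 1) P + \<rho> I) v\<close>, whose Rayleigh identity is divided by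
  \<open>E x + E y\<close>.\<close>

lemma preconditioned_eigenvalue_bound:
  fixes \<rho> C \<delta> \<delta>l :: real and \<theta> :: "nat \<Rightarrow> real" and lam :: complex
  assumes A: "A \<in> carrier_mat m n" and m: "m > 0" and n: "n > 0"
    and \<rho>: "\<rho> = real m / real n" and \<rho>1: "\<rho> \<le> 1"
    and \<theta>: "\<And>j. j < n \<Longrightarrow> \<theta> j > 0" and C: "C > 0" and \<delta>l: "\<delta>l > 0"
    and P2: "property_P2 A (card {j. j < n \<and> inverse (\<theta> j) < C}) \<delta>l"
    and P1: "property_P1 A \<delta>" and \<delta>: "\<delta> \<ge> 0" and g: "1 + \<delta> \<le> g"
    and H: "H = mat_inv (mat_diag n \<theta>) + transpose_mat A * A"
    and P: "P = mat_inv (mat_diag n \<theta>) + \<rho> \<cdot>\<^sub>m 1\<^sub>m n"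
    and ev: "eigenvalue (map_mat complex_of_real (mat_inv P * H)) lam"
  shows "cmod (lam - 1) \<le> \<delta>l + 1/4 * (g\<^sup>2 / (\<rho> * \<delta>l * C))"
proof -
  define p where "p i = inverse (\<theta> i) + \<rho>" for i
  have p: "p i > 0" if "i < n" for i using \<theta>[OF that] m n by (simp add: p_def \<rho> add_pos_pos)
  have inv_\<theta>: "mat_inv (mat_diag n \<theta>) = mat_diag n (\<lambda>i. inverse (\<theta> i))"
    by (rule mat_inv_mat_diag) (use \<theta> in force)
  have "P = mat_diag n p" unfolding P inv_\<theta> by (auto simp: mat_diag_def p_def intro!: eq_matI)
  moreover have "mat_inv (mat_diag n p) = mat_diag n (\<lambda>i. inverse (p i))"
    by (rule mat_inv_mat_diag) (use p in force)
  moreover have Hdim: "H \<in> carrier_mat n n" using A by (simp add: H inv_\<theta>)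
  ultimately have M: "mat_inv P * H = mat n n (\<lambda>(i, j). inverse (p i) * H $$ (i, j))"
    by (simp add: mat_diag_mult_left)
  obtain v where v: "v \<in> carrier_vec n" "v \<noteq> 0\<^sub>v n"
    and Mv: "map_mat complex_of_real (mat_inv P * H) *\<^sub>v v = lam \<cdot>\<^sub>v v"
    using ev by (auto simp: eigenvalue_def eigenvector_def M)
  define x where "x = map_vec Re v"
  define y where "y = map_vec Im v"
  have xy: "x \<in> carrier_vec n" "y \<in> carrier_vec n" using v by (auto simp: x_def y_def)
  define E where "E z = (\<Sum>j<n. p j * (z $ j)\<^sup>2)" for z
  define q where "q z = (A *\<^sub>v z) \<bullet> (A *\<^sub>v z) - \<rho> * (z \<bullet> z)" for z
  define K where "K = \<delta>l + 1/4 * (g\<^sup>2 / (\<rho> * \<delta>l * C))"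
  have row: "(\<Sum>j<n. of_real ((transpose_mat A * A) $$ (i, j)) * v $ j)
      = ((lam - 1) * of_real (p i) + of_real \<rho>) * v $ i" if i: "i < n" for i
  proof -
    let ?G = "\<lambda>j. (transpose_mat A * A) $$ (i, j)"
    have Hij: "H $$ (i, j) = (if i = j then inverse (\<theta> i) else 0) + ?G j" if "j < n" for j
      using i that A by (simp add: H inv_\<theta>) (simp add: mat_diag_def)
    have "lam * v $ i = (map_mat complex_of_real (mat_inv P * H) *\<^sub>v v) $ i"
      using Mv v i by simp
    also have "\<dots> = (\<Sum>j<n. of_real (inverse (p i)) * (of_real (H $$ (i, j)) * v $ j))"
      using i v by (simp add: M scalar_prod_def lessThan_atLeast0 mult.assoc)
    also have "\<dots> = of_real (inverse (p i)) * (\<Sum>j<n. of_real (H $$ (i, j)) * v $ j)"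
      by (rule sum_distrib_left[symmetric])
    also have "(\<Sum>j<n. of_real (H $$ (i, j)) * v $ j)
        = (\<Sum>j<n. (if i = j then of_real (inverse (\<theta> i)) * v $ i else 0) + of_real (?G j) * v $ j)"
      by (intro sum.cong refl) (auto simp: Hij distrib_right simp del: index_mult_mat)
    also have "\<dots> = of_real (inverse (\<theta> i)) * v $ i + (\<Sum>j<n. of_real (?G j) * v $ j)"
      using i by (simp add: sum.distrib del: index_mult_mat)
    finally have "of_real (p i) * (lam * v $ i) =
        of_real (inverse (\<theta> i)) * v $ i + (\<Sum>j<n. of_real (?G j) * v $ j)"
      using p[OF i] by (simp add: field_simps del: index_mult_mat)
    then have "(\<Sum>j<n. of_real (?G j) * v $ j) =
        of_real (p i) * (lam * v $ i) - of_real (inverse (\<theta> i)) * v $ i"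
      by (simp del: index_mult_mat)
    \<comment> \<open>This substitution turns the factor \<open>lam\<close> into
      \<open>lam - 1\<close> and produces the shift \<open>\<rho>\<close>.\<close>
    also have "inverse (\<theta> i) = p i - \<rho>" by (simp add: p_def)
    finally show ?thesis by (simp add: algebra_simps del: index_mult_mat)
  qed
  have rayleigh: "complex_of_real (q x + q y) = (lam - 1) * of_real (E x + E y)"
    using gram_rayleigh_complex[OF A v(1) row] by (simp add: q_def E_def x_def y_def algebra_simps)
  have dev: "\<bar>q z\<bar> \<le> K * E z" if "z \<in> carrier_vec n" for z
    unfolding q_def K_def E_def p_def
    by (rule gram_form_deviation[OF A that m n \<rho> \<rho>1 \<theta> C \<delta>l P2 P1 \<delta> g])
  have E0: "0 \<le> E z" for z by (auto simp: E_def intro!: sum_nonneg mult_nonneg_nonneg less_imp_le[OF p])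
  \<comment> \<open>A nonzero coordinate of \<open>v\<close> has nonzero real or imaginary part, and
    its weight \<open>p j\<close> is positive.\<close>
  have "E x + E y > 0"
  proof -
    obtain j where j: "j < n" "v $ j \<noteq> 0" using v by (metis eq_vecI carrier_vecD index_zero_vec)
    have le: "p j * (z $ j)\<^sup>2 \<le> E z" for z
      unfolding E_def using j by (intro member_le_sum) (auto intro!: mult_nonneg_nonneg less_imp_le[OF p])
    have "0 < p j * ((x $ j)\<^sup>2 + (y $ j)\<^sup>2)"
      using j p v by (intro mult_pos_pos) (auto simp: x_def y_def complex_neq_0[symmetric])
    also have "\<dots> \<le> E x + E y" using le[of x] le[of y] by (simp add: distrib_left)
    finally show ?thesis .
  qed
  moreover have "cmod (lam - 1) * (E x + E y) = \<bar>q x + q y\<bar>"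
    using arg_cong[OF rayleigh, of cmod] E0[of x] E0[of y]
    by (simp add: norm_mult del: of_real_add)
  moreover have "\<dots> \<le> K * (E x + E y)"
    using dev[OF xy(1)] dev[OF xy(2)] by (simp add: distrib_left)
  ultimately have "cmod (lam - 1) \<le> K" using mult_le_cancel_right_pos[of "E x + E y"] by metis
  then show ?thesis by (simp only: K_def)
qed

theorem lemma1:
  fixes m n l :: nat
    and A \<Theta> H P :: "real mat"
    and \<theta> :: "nat \<Rightarrow> real"
    and \<rho> C \<delta>l :: real
  assumes m_pos: "m > 0" and n_pos: "n > 0"
    and m_le: "real m \<le> real n / 2"
    and rho: "\<rho> = real m / real n"
    and A: "A \<in> carrier_mat m n"
    and Theta: "\<Theta> = mat_diag n \<theta>"
    and theta_pos: "\<And>j. j < n \<Longrightarrow> \<theta> j > 0"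
    and H: "H = mat_inv \<Theta> + transpose_mat A * A"
    and P: "P = mat_inv \<Theta> + \<rho> \<cdot>\<^sub>m 1\<^sub>m n"
    and C_pos: "C > 0"
    and l: "l = card {j. j < n \<and> inverse (\<theta> j) < C}"
    and delta_l_pos: "\<delta>l > 0"
    and P2: "property_P2 A l \<delta>l"
  shows "(A * transpose_mat A = 1\<^sub>m m \<longrightarrow>
            (\<forall>lam:: complex. eigenvalue (map_mat complex_of_real (mat_inv P * H)) lam \<longrightarrow>
               cmod (lam - 1) \<le> \<delta>l + 1/4 * ((3 - \<rho>)\<^sup>2 / (\<rho> * \<delta>l * C))))
       \<and> (\<forall>\<delta> :: real. \<delta> \<ge> 0 \<and> property_P1 A \<delta> \<longrightarrow>
            (\<forall>lam:: complex. eigenvalue (map_mat complex_of_real (mat_inv P * H)) lam \<longrightarrow>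
               cmod (lam - 1) \<le> \<delta>l + 1/4 * ((1 + \<delta> - \<rho> + 2 * sqrt (1 + \<delta>))\<^sup>2 / (\<rho> * \<delta>l * C))))"
proof -
  have \<rho>: "0 < \<rho>" "\<rho> \<le> 1" using m_pos n_pos m_le by (simp_all add: rho)
  note bound = preconditioned_eigenvalue_bound[OF A m_pos n_pos rho \<rho>(2) theta_pos C_pos delta_l_pos
      P2[unfolded l] _ _ _ H[unfolded Theta] P[unfolded Theta]]
  have "cmod (lam - 1) \<le> \<delta>l + 1/4 * ((3 - \<rho>)\<^sup>2 / (\<rho> * \<delta>l * C))"
    if "A * transpose_mat A = 1\<^sub>m m"
      and "eigenvalue (map_mat complex_of_real (mat_inv P * H)) lam" for lam
    \<comment> \<open>Here \<open>\<delta> = 0\<close> and \<open>g = 3 - \<rho>\<close>, which is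
      at least \<open>1\<close>.\<close>
    using property_P1_orthonormal[OF A that(1)] that(2) \<rho> by (intro bound[of 0]) auto
  moreover have "cmod (lam - 1) \<le>
      \<delta>l + 1/4 * ((1 + \<delta> - \<rho> + 2 * sqrt (1 + \<delta>))\<^sup>2 / (\<rho> * \<delta>l * C))"
    if "\<delta> \<ge> 0" "property_P1 A \<delta>"
      and "eigenvalue (map_mat complex_of_real (mat_inv P * H)) lam" for \<delta> lam
  proof -
    \<comment> \<open>For this choice of \<open>g\<close>, the condition
      \<open>1 + \<delta> \<le> g\<close> amounts to
      \<open>\<rho> \<le> 2 * sqrt (1 + \<delta>)\<close>.\<close>
    have "1 \<le> sqrt (1 + \<delta>)" using that(1) by simp
    then have "\<rho> \<le> 2 * sqrt (1 + \<delta>)" using \<rho> by linarith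
    then show ?thesis using that by (intro bound[of \<delta>]) auto
  qed
  ultimately show ?thesis by blast
qed

end
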